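(* For a nonempty $\Pi^0_1$ set $P\subseteq2^{\mathbb N}$ the following are equivalent: $P$ is $(1,<\omega)$-complete; $P$ is $(1,\omega|<\omega)$-complete; $P$ is $(<\omega,1)$-complete.
   Context: Let $\{\Phi_e\}_{e\in\mathbb N}$ be an effective enumeration of all partial computable functions $\Phi_e:\subseteq\mathbb N^{\mathbb N}\to\mathbb N^{\mathbb N}$. A learner is a total computable function $\Psi:\mathbb N^{<\mathbb N}\to\mathbb N$. A partial function $\Gamma:\subseteq\mathbb N^{\mathbb N}\to\mathbb N^{\mathbb N}$ is identified by $\Psi$ if for every $g\in\mathrm{dom}(\Gamma)$ the limit $\lim_n\Psi(g\upharpoonright n)$ exists and $\Phi_{\lim_n\Psi(g\upharpoonright n)}(g)=\Gamma(g)$. $\Gamma$ is $(1,<\omega)$-computable if it is identified by a learner $\Psi$ with $\sup_{g\in\mathrm{dom}(\Gamma)}\#\{n:\Psi(g\upharpoonright (n+1))\neq\Psi(g\upharpoonright n)\}<\omega$. $\Gamma$ is $(1,\omega|<\omega)$-computable if it is identified by a learner $\Psi$ with $\sup_{g\in\mathrm{dom}(\Gamma)}\#\{\Psi(g\upharpoonright n):n\in\mathbb N\}<\omega$. $\Gamma$ is $(<\omega,1)$-computable if there is $b\in\mathbb N$ such that for every $g\in\mathrm{dom}(\Gamma)$, $\Gamma(g)=\Phi_e(g)$ for some $e<b$. For each of these three notions (written $(\alpha,\beta|\gamma)$) and $A,B\subseteq\mathbb N^{\mathbb N}$, $A\le^\alpha_{\beta|\gamma}B$ means there is a partial function $\Gamma$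 computable in that sense with $B\subseteq\mathrm{dom}(\Gamma)$ and $\Gamma(g)\in A$ for every $g\in B$. A nonempty $\Pi^0_1$ set $P\subseteq2^{\mathbb N}$ is $(\alpha,\beta|\gamma)$-complete if $Q\le^\alpha_{\beta|\gamma}P$ for every nonempty $\Pi^0_1$ set $Q\subseteq 2^{\mathbb N}$. *)

theory Defs
  imports Complex_Main "HOL-Library.Nat_Bijection"
begin

type_synonym baire = "nat \<Rightarrow> nat"

text \<open>
  Kleene's partial recursive functions relative to an oracle. All programs are unary; several
  arguments are packed with the pairing bijection \<^const>\<open>prod_encode\<close>.
\<close>

datatype prog =
    PZero
  | PSucc
  | PFst
  | PSnd
  | POracle
  | PPair prog prog
  | PComp prog prog
  | PRec prog prog
  | PMu prog

definition mu_search :: "(nat \<Rightarrow> nat option) \<Rightarrow> nat option" where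
  "mu_search f =
     (if \<exists>n. f n = Some 0 \<and> (\<forall>m<n. f m \<noteq> None) then Some (LEAST n. f n = Some 0) else None)"

primrec eval_prog :: "baire \<Rightarrow> prog \<Rightarrow> nat \<Rightarrow> nat option" where
  "eval_prog g PZero = (\<lambda>x. Some 0)"
| "eval_prog g PSucc = (\<lambda>x. Some (Suc x))"
| "eval_prog g PFst = (\<lambda>x. Some (fst (prod_decode x)))"
| "eval_prog g PSnd = (\<lambda>x. Some (snd (prod_decode x)))"
| "eval_prog g POracle = (\<lambda>x. Some (g x))"
| "eval_prog g (PPair p q) =
     (\<lambda>x. Option.bind (eval_prog g p x) (\<lambda>u.
          Option.bind (eval_prog g q x) (\<lambda>v. Some (prod_encode (u, v)))))"
| "eval_prog g (PComp p q) = (\<lambda>x. Option.bind (eval_prog g q x) (eval_prog g p))"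
| "eval_prog g (PRec p q) =
     (\<lambda>x. case prod_decode x of (y, n) \<Rightarrow>
        rec_nat (eval_prog g p y)
          (\<lambda>i r. Option.bind r (\<lambda>v. eval_prog g q (prod_encode (y, prod_encode (i, v))))) n)"
| "eval_prog g (PMu p) = (\<lambda>x. mu_search (\<lambda>n. eval_prog g p (prod_encode (x, n))))"

primrec oracle_free :: "prog \<Rightarrow> bool" where
  "oracle_free PZero = True"
| "oracle_free PSucc = True"
| "oracle_free PFst = True"
| "oracle_free PSnd = True"
| "oracle_free POracle = False"
| "oracle_free (PPair p q) = (oracle_free p \<and> oracle_free q)"
| "oracle_free (PComp p q) = (oracle_free p \<and> oracle_free q)"
| "oracle_free (PRec p q) = (oracle_free p \<and> oracle_free q)"
| "oracle_free (PMu p) = oracle_free p"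

text \<open>Total computable functions on finite strings. The oracle \<open>g\<close> is irrelevant here.\<close>

definition computable_str :: "(nat list \<Rightarrow> nat) \<Rightarrow> bool" where
  "computable_str h \<longleftrightarrow>
     (\<exists>p. oracle_free p \<and> (\<forall>g \<sigma>. eval_prog g p (list_encode \<sigma>) = Some (h \<sigma>)))"

text \<open>A sequence of outputs is an element of Baire space only if all outputs are defined.\<close>

definition total_seq :: "(nat \<Rightarrow> nat option) \<Rightarrow> baire option" where
  "total_seq f = (if \<forall>n. f n \<noteq> None then Some (\<lambda>n. the (f n)) else None)"

definition partial_computable :: "(baire \<rightharpoonup> baire) \<Rightarrow> bool" where
  "partial_computable \<Gamma> \<longleftrightarrow> (\<exists>p. \<forall>g. \<Gamma> g = total_seq (eval_prog g p))"

text \<open>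
  The enumeration consists of exactly the partial computable functions, and it is effective:
  one program computes \<open>\<Phi> e g\<close> uniformly in \<open>e\<close> and \<open>g\<close>. No s-m-n property is required.
\<close>

definition effective_enumeration :: "(nat \<Rightarrow> baire \<rightharpoonup> baire) \<Rightarrow> bool" where
  "effective_enumeration \<Phi> \<longleftrightarrow>
     range \<Phi> = {\<Gamma>. partial_computable \<Gamma>} \<and>
     (\<exists>u. \<forall>e g. \<Phi> e g = total_seq (\<lambda>n. eval_prog g u (prod_encode (e, n))))"

definition init_seg :: "baire \<Rightarrow> nat \<Rightarrow> nat list" where
  "init_seg g n = map g [0..<n]"

definition identified_by :: "(nat \<Rightarrow> baire \<rightharpoonup> baire) \<Rightarrow> (baire \<rightharpoonup> baire) \<Rightarrow> (nat list \<Rightarrow> nat) \<Rightarrow> bool" where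
  "identified_by \<Phi> \<Gamma> \<Psi> \<longleftrightarrow>
     (\<forall>g\<in>dom \<Gamma>. \<exists>e. (\<forall>\<^sub>F n in sequentially. \<Psi> (init_seg g n) = e) \<and> \<Phi> e g = \<Gamma> g)"

definition mind_changes :: "(nat list \<Rightarrow> nat) \<Rightarrow> baire \<Rightarrow> nat set" where
  "mind_changes \<Psi> g = {n. \<Psi> (init_seg g (n + 1)) \<noteq> \<Psi> (init_seg g n)}"

definition hypotheses :: "(nat list \<Rightarrow> nat) \<Rightarrow> baire \<Rightarrow> nat set" where
  "hypotheses \<Psi> g = {\<Psi> (init_seg g n) | n. True}"

text \<open>The notions \<open>(1,<\<omega>)\<close>, \<open>(1,\<omega>|<\<omega>)\<close> and \<open>(<\<omega>,1)\<close>, in this order.\<close>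

definition computable_1_fin :: "(nat \<Rightarrow> baire \<rightharpoonup> baire) \<Rightarrow> (baire \<rightharpoonup> baire) \<Rightarrow> bool" where
  "computable_1_fin \<Phi> \<Gamma> \<longleftrightarrow>
     (\<exists>\<Psi>. computable_str \<Psi> \<and> identified_by \<Phi> \<Gamma> \<Psi> \<and>
       (\<exists>k. \<forall>g\<in>dom \<Gamma>. finite (mind_changes \<Psi> g) \<and> card (mind_changes \<Psi> g) \<le> k))"

definition computable_1_omega_fin :: "(nat \<Rightarrow> baire \<rightharpoonup> baire) \<Rightarrow> (baire \<rightharpoonup> baire) \<Rightarrow> bool" where
  "computable_1_omega_fin \<Phi> \<Gamma> \<longleftrightarrow>
     (\<exists>\<Psi>. computable_str \<Psi> \<and> identified_by \<Phi> \<Gamma> \<Psi> \<and>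
       (\<exists>k. \<forall>g\<in>dom \<Gamma>. finite (hypotheses \<Psi> g) \<and> card (hypotheses \<Psi> g) \<le> k))"

definition computable_fin_1 :: "(nat \<Rightarrow> baire \<rightharpoonup> baire) \<Rightarrow> (baire \<rightharpoonup> baire) \<Rightarrow> bool" where
  "computable_fin_1 \<Phi> \<Gamma> \<longleftrightarrow> (\<exists>b. \<forall>g\<in>dom \<Gamma>. \<exists>e<b. \<Gamma> g = \<Phi> e g)"

definition cantor :: "baire set" where
  "cantor = {g. \<forall>n. g n \<in> {0, 1}}"

text \<open>Lightface \<open>\<Pi>\<^sup>0\<^sub>1\<close> sets: all initial segments satisfy a decidable predicate.\<close>

definition pi01 :: "baire set \<Rightarrow> bool" where
  "pi01 P \<longleftrightarrow>
     (\<exists>T. computable_str (\<lambda>\<sigma>. of_bool (\<sigma> \<in> T)) \<and> P = {g. \<forall>n. init_seg g n \<in> T})"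

text \<open>
  Reducibility \<open>A \<le> B\<close> and completeness, for a class \<open>C\<close> of partial functions on Baire space.
\<close>

definition reducible :: "((baire \<rightharpoonup> baire) \<Rightarrow> bool) \<Rightarrow> baire set \<Rightarrow> baire set \<Rightarrow> bool" where
  "reducible C A B \<longleftrightarrow> (\<exists>\<Gamma>. C \<Gamma> \<and> B \<subseteq> dom \<Gamma> \<and> (\<forall>g\<in>B. the (\<Gamma> g) \<in> A))"

definition complete_for :: "((baire \<rightharpoonup> baire) \<Rightarrow> bool) \<Rightarrow> baire set \<Rightarrow> bool" where
  "complete_for C P \<longleftrightarrow> (\<forall>Q. Q \<subseteq> cantor \<and> pi01 Q \<and> Q \<noteq> {} \<longrightarrow> reducible C Q P)"

end

theory Submission
  imports Defs "HOL-Library.More_List"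
begin

text \<open>
  A learner with boundedly many mind changes has boundedly many hypotheses along each \<open>g\<close>, and a
  learner with at most \<open>k\<close> hypotheses can be replaced by the \<open>k\<close> functions that follow the first,
  second, \<open>\<dots>\<close> distinct hypothesis. So only the step from \<open>(<\<omega>,1)\<close> to \<open>(1,<\<omega>)\<close> uses completeness.

  Given \<open>R\<close>, the paths of a tree \<open>T\<close>, apply \<open>(<\<omega>,1)\<close>-completeness to a separating class: the set of all
  \<open>x\<close> choosing at each string \<open>\<sigma>\<close> a bit whose subtree does not die before that of the other bit.
  Following these choices from the root computes a member of \<open>R\<close>. Every \<open>g \<in> P\<close> then has \<open>b\<close> partial
  candidates, one of which is total and in this class. The learner drops a candidate once it outputs
  a wrong bit, which happens at most \<open>b\<close> times. The remaining candidates may be partial, but all their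
  outputs are right, and since the constraint on \<open>x\<close> is a separate condition on each value \<open>x n\<close>, taking
  at each place the first output found among them gives a total member of the class.
\<close>

section \<open>Computable functionals\<close>

abbreviation pfst :: "nat \<Rightarrow> nat" where "pfst z \<equiv> fst (prod_decode z)"
abbreviation psnd :: "nat \<Rightarrow> nat" where "psnd z \<equiv> snd (prod_decode z)"

text \<open>With \<open>b\<close> true the program is oracle-free, so one set of closure rules
  serves functionals of the oracle and, through \<open>computable_strI\<close>, functions on
  strings. Only total functionals are covered; partial ones are handled by explicit
  programs.\<close>

definition computable_fn :: "bool \<Rightarrow> (baire \<Rightarrow> nat \<Rightarrow> nat) \<Rightarrow> bool" where
  "computable_fn b F \<longleftrightarrow>
     (\<exists>p. (b \<longrightarrow> oracle_free p) \<and> (\<forall>g x. eval_prog g p x = Some (F g x)))"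

definition decidable :: "bool \<Rightarrow> (baire \<Rightarrow> nat \<Rightarrow> bool) \<Rightarrow> bool" where
  "decidable b P \<longleftrightarrow> computable_fn b (\<lambda>g x. of_bool (P g x))"

named_theorems computability

lemma computable_fn_id [computability]: "computable_fn b (\<lambda>g x. x)"
  unfolding computable_fn_def by (rule exI[of _ "PPair PFst PSnd"]) simp

lemma computable_fn_zero: "computable_fn b (\<lambda>g x. 0)"
  unfolding computable_fn_def by (rule exI[of _ PZero]) simp

lemma computable_fn_Suc [computability]:
  assumes "computable_fn b F"
  shows "computable_fn b (\<lambda>g x. Suc (F g x))"
proof -
  from assms obtain p where "b \<longrightarrow> oracle_free p" "\<forall>g x. eval_prog g p x = Some (F g x)"
    unfolding computable_fn_def by blast
  then show ?thesis unfolding computable_fn_def by (intro exI[of _ "PComp PSucc p"]) simp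
qed

lemma computable_fn_const [computability]: "computable_fn b (\<lambda>g x. c)"
  by (induction c) (auto intro: computable_fn_zero computable_fn_Suc)

lemma computable_fn_pfst [computability]:
  assumes "computable_fn b F"
  shows "computable_fn b (\<lambda>g x. pfst (F g x))"
proof -
  from assms obtain p where "b \<longrightarrow> oracle_free p" "\<forall>g x. eval_prog g p x = Some (F g x)"
    unfolding computable_fn_def by blast
  then show ?thesis unfolding computable_fn_def by (intro exI[of _ "PComp PFst p"]) simp
qed

lemma computable_fn_psnd [computability]:
  assumes "computable_fn b F"
  shows "computable_fn b (\<lambda>g x. psnd (F g x))"
proof -
  from assms obtain p where "b \<longrightarrow> oracle_free p" "\<forall>g x. eval_prog g p x = Some (F g x)"
    unfolding computable_fn_def by blast
  then show ?thesis unfolding computable_fn_def by (intro exI[of _ "PComp PSnd p"]) simp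
qed

lemma computable_fn_oracle [computability]:
  assumes "computable_fn False F"
  shows "computable_fn False (\<lambda>g x. g (F g x))"
proof -
  from assms obtain p where "\<forall>g x. eval_prog g p x = Some (F g x)"
    unfolding computable_fn_def by blast
  then show ?thesis unfolding computable_fn_def by (intro exI[of _ "PComp POracle p"]) simp
qed

lemma computable_fn_pair [computability]:
  assumes "computable_fn b F" "computable_fn b G"
  shows "computable_fn b (\<lambda>g x. prod_encode (F g x, G g x))"
proof -
  from assms obtain p q where
    "b \<longrightarrow> oracle_free p" "\<forall>g x. eval_prog g p x = Some (F g x)"
    "b \<longrightarrow> oracle_free q" "\<forall>g x. eval_prog g q x = Some (G g x)"
    unfolding computable_fn_def by blast
  then show ?thesis unfolding computable_fn_def by (intro exI[of _ "PPair p q"]) simp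
qed

lemma computable_fn_comp:
  assumes "computable_fn b F" "computable_fn b G"
  shows "computable_fn b (\<lambda>g x. F g (G g x))"
proof -
  from assms obtain p q where
    "b \<longrightarrow> oracle_free p" "\<forall>g x. eval_prog g p x = Some (F g x)"
    "b \<longrightarrow> oracle_free q" "\<forall>g x. eval_prog g q x = Some (G g x)"
    unfolding computable_fn_def by blast
  then show ?thesis unfolding computable_fn_def by (intro exI[of _ "PComp p q"]) simp
qed

text \<open>Under a bound variable the input becomes the pair of \<open>x\<close> and that variable;
  a functional of \<open>x\<close> alone has to be read off the first component.\<close>

lemma computable_fn_lift:
  "computable_fn b F \<Longrightarrow> computable_fn b (\<lambda>g z. F g (pfst z))"
  using computable_fn_comp[of b F "\<lambda>g z. pfst z"] by (simp add: computable_fn_pfst computable_fn_id)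

text \<open>The central closure rule, to which addition, case distinction, bounded sums and list
  codes are reduced. In the second premise \<open>z\<close> packs \<open>x\<close>, the counter and
  the previous value in the way \<open>PRec\<close> does.\<close>

lemma computable_fn_rec [computability]:
  assumes "computable_fn b A"
    and "computable_fn b (\<lambda>g z. B g (pfst z) (pfst (psnd z)) (psnd (psnd z)))"
    and "computable_fn b N"
  shows "computable_fn b (\<lambda>g x. rec_nat (A g x) (\<lambda>i r. B g x i r) (N g x))"
proof -
  from assms obtain p q r where p:
    "b \<longrightarrow> oracle_free p" "\<And>g x. eval_prog g p x = Some (A g x)"
    and q: "b \<longrightarrow> oracle_free q"
    "\<And>g z. eval_prog g q z = Some (B g (pfst z) (pfst (psnd z)) (psnd (psnd z)))"
    and r: "b \<longrightarrow> oracle_free r" "\<And>g x. eval_prog g r x = Some (N g x)"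
    unfolding computable_fn_def by blast
  have "rec_nat (Some (A g x))
      (\<lambda>i r. Option.bind r (\<lambda>v. eval_prog g q (prod_encode (x, prod_encode (i, v))))) n
      = Some (rec_nat (A g x) (\<lambda>i r. B g x i r) n)" for g x n
    by (induction n) (simp_all add: q)
  then show ?thesis unfolding computable_fn_def using p q r
    by (intro exI[of _ "PComp (PRec p q) (PPair (PPair PFst PSnd) r)"]) simp
qed

lemma computable_fn_add [computability]:
  assumes "computable_fn b F" "computable_fn b G"
  shows "computable_fn b (\<lambda>g x. F g x + G g x)"
proof -
  have "m + n = rec_nat m (\<lambda>i r. Suc r) n" for m n :: nat by (induction n) simp_all
  then show ?thesis by (simp only:) (intro computability assms)
qed

lemma computable_fn_pred:
  assumes "computable_fn b F"
  shows "computable_fn b (\<lambda>g x. F g x - 1)"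
proof -
  have "n - 1 = rec_nat 0 (\<lambda>i r. i) n" for n :: nat by (cases n) simp_all
  then show ?thesis by (simp only:) (intro computability assms)
qed

lemma computable_fn_diff [computability]:
  assumes "computable_fn b F" "computable_fn b G"
  shows "computable_fn b (\<lambda>g x. F g x - G g x)"
proof -
  have "rec_nat m (\<lambda>i r. r - 1) n = m - n" for m n :: nat by (induction n) simp_all
  moreover have "computable_fn b (\<lambda>g x. rec_nat (F g x) (\<lambda>i r. r - 1) (G g x))"
    by (intro computability assms computable_fn_pred)
  ultimately show ?thesis by (simp only:)
qed

lemma computable_fn_of_bool [computability]:
  "decidable b P \<Longrightarrow> computable_fn b (\<lambda>g x. of_bool (P g x))"
  by (simp add: decidable_def)

lemma computable_fn_if [computability]:
  assumes "decidable b P" "computable_fn b F" "computable_fn b G"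
  shows "computable_fn b (\<lambda>g x. if P g x then F g x else G g x)"
proof -
  have "(if Q then m else n) = rec_nat n (\<lambda>i r. m) (of_bool Q)" for Q and m n :: nat
    by (cases Q) simp_all
  then show ?thesis by (simp only:) (intro computability assms computable_fn_lift)
qed

section \<open>Decidable predicates, bounded sums and bounded quantifiers\<close>

lemma decidable_less [computability]:
  assumes "computable_fn b F" "computable_fn b G"
  shows "decidable b (\<lambda>g x. F g x < G g x)"
proof -
  have "(of_bool (m < n) :: nat) = rec_nat 0 (\<lambda>i r. 1) (n - m)" for m n :: nat
    by (cases "n - m") auto
  then show ?thesis unfolding decidable_def by (simp only:) (intro computability assms)
qed

lemma decidable_not [computability]:
  assumes "decidable b P"
  shows "decidable b (\<lambda>g x. \<not> P g x)"
proof -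
  have "of_bool (\<not> Q) = (1::nat) - of_bool Q" for Q by simp
  then show ?thesis unfolding decidable_def by (simp only:) (intro computability assms)
qed

lemma decidable_conj [computability]:
  assumes "decidable b P" "decidable b Q"
  shows "decidable b (\<lambda>g x. P g x \<and> Q g x)"
proof -
  have "of_bool (p \<and> q) = (if p then of_bool q else (0::nat))" for p q by simp
  then show ?thesis unfolding decidable_def by (simp only:) (intro computability assms)
qed

lemma decidable_disj [computability]:
  assumes "decidable b P" "decidable b Q"
  shows "decidable b (\<lambda>g x. P g x \<or> Q g x)"
proof -
  have "(p \<or> q) = (\<not> (\<not> p \<and> \<not> q))" for p q by simp
  then show ?thesis by (simp only:) (intro computability assms)
qed

lemma decidable_le [computability]:
  assumes "computable_fn b F" "computable_fn b G"
  shows "decidable b (\<lambda>g x. F g x \<le> G g x)"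
  unfolding not_less[symmetric] by (intro computability assms)

lemma decidable_eq [computability]:
  assumes "computable_fn b F" "computable_fn b G"
  shows "decidable b (\<lambda>g x. F g x = G g x)"
proof -
  have "(m = n) = (\<not> m < n \<and> \<not> n < m)" for m n :: nat by auto
  then show ?thesis by (simp only:) (intro computability assms)
qed

lemma computable_fn_sum [computability]:
  assumes "computable_fn b (\<lambda>g z. F g (pfst z) (psnd z))" "computable_fn b N"
  shows "computable_fn b (\<lambda>g x. \<Sum>i<N g x. F g x i)"
proof -
  \<comment> \<open>Inside the recursion the summand receives input, counter and partial sum, and
    has to ignore the last.\<close>
  have "computable_fn b (\<lambda>g z. F g (pfst z) (pfst (psnd z)))"
    using computable_fn_comp[OF assms(1), of "\<lambda>g z. prod_encode (pfst z, pfst (psnd z))"]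
    by (simp add: computability)
  moreover have "(\<Sum>i<n. f i) = rec_nat 0 (\<lambda>i r. r + f i) n" for f :: "nat \<Rightarrow> nat" and n
    by (induction n) simp_all
  ultimately show ?thesis by (simp only:) (intro computability assms)
qed

lemma decidable_ex [computability]:
  assumes "decidable b (\<lambda>g z. P g (pfst z) (psnd z))" "computable_fn b N"
  shows "decidable b (\<lambda>g x. \<exists>i<N g x. P g x i)"
proof -
  have "(\<exists>i<n. Q i) \<longleftrightarrow> 0 < (\<Sum>i<n. of_bool (Q i) :: nat)" for Q and n :: nat
    by (auto simp: sum_nonneg_eq_0_iff simp flip: neq0_conv)
  then show ?thesis by (simp only:) (intro computability assms)
qed

lemma decidable_all [computability]:
  assumes "decidable b (\<lambda>g z. P g (pfst z) (psnd z))" "computable_fn b N"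
  shows "decidable b (\<lambda>g x. \<forall>i<N g x. P g x i)"
proof -
  have "(\<forall>i<n. Q i) \<longleftrightarrow> \<not> (\<exists>i<n. \<not> Q i)" for Q and n :: nat by auto
  then show ?thesis by (simp only:) (intro computability assms)
qed

section \<open>Operations on codes of finite strings\<close>

lemma computable_fn_list_code [computability]:
  "computable_fn b F \<Longrightarrow> computable_fn b (\<lambda>g x. list_encode (list_decode (F g x)))"
  by simp

text \<open>A nonempty list has code \<open>Suc (prod_encode (a, c))\<close> with \<open>c\<close>
  the code of its tail, so \<open>psnd (r - 1)\<close> removes the head; at code 0, truncation and
  \<open>prod_decode 0 = (0, 0)\<close> keep the value 0.\<close>

lemma list_encode_drop:
  "list_encode (drop i xs) = rec_nat (list_encode xs) (\<lambda>i r. psnd (r - 1)) i"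
proof (induction i)
  case (Suc i)
  have "prod_decode 0 = (0, 0)"
    using prod_encode_inverse[of "(0, 0)"] by (simp add: prod_encode_def)
  then have "list_encode (tl ys) = psnd (list_encode ys - 1)" for ys
    by (cases ys) simp_all
  moreover have "drop (Suc i) xs = tl (drop i xs)" by (simp add: drop_Suc tl_drop)
  ultimately show ?case using Suc by simp
qed simp

lemma computable_fn_drop:
  assumes "computable_fn b (\<lambda>g x. list_encode (L g x))" "computable_fn b I"
  shows "computable_fn b (\<lambda>g x. list_encode (drop (I g x) (L g x)))"
  unfolding list_encode_drop by (intro computability assms)

lemma length_le_list_encode: "length xs \<le> list_encode xs"
  by (induction xs) (auto intro: order_trans[OF _ le_prod_encode_2])

lemma computable_fn_length [computability]:
  assumes "computable_fn b (\<lambda>g x. list_encode (L g x))"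
  shows "computable_fn b (\<lambda>g x. length (L g x))"
proof -
  have L: "computable_fn b (\<lambda>g z. list_encode (L g (pfst z)))"
    using assms by (rule computable_fn_lift)
  \<comment> \<open>The length is the number of nonempty final segments; the code itself bounds the
    indices to be tested.\<close>
  have len: "length xs = (\<Sum>i<list_encode xs. of_bool (0 < list_encode (drop i xs)))" for xs
  proof -
    have "0 < list_encode ys \<longleftrightarrow> ys \<noteq> []" for ys by (cases ys) simp_all
    then have "(\<Sum>i<list_encode xs. of_bool (0 < list_encode (drop i xs))) =
        (\<Sum>i<list_encode xs. of_bool (i < length xs) :: nat)"
      by (intro sum.cong) auto
    also have "\<dots> = card ({..<list_encode xs} \<inter> {..<length xs})"
      by (simp add: lessThan_def)
    also have "{..<list_encode xs} \<inter> {..<length xs} = {..<length xs}"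
      using length_le_list_encode[of xs] by auto
    finally show ?thesis by simp
  qed
  show ?thesis
    by (subst len, intro computability computable_fn_drop assms L)
qed

lemma computable_fn_nth_default [computability]:
  assumes "computable_fn b (\<lambda>g x. list_encode (L g x))" "computable_fn b I"
  shows "computable_fn b (\<lambda>g x. nth_default 0 (L g x) (I g x))"
proof -
  have "prod_decode 0 = (0, 0)"
    using prod_encode_inverse[of "(0, 0)"] by (simp add: prod_encode_def)
  \<comment> \<open>Beyond the end the dropped list has code 0, whose first component is the wanted
    default.\<close>
  then have "nth_default 0 xs i = pfst (list_encode (drop i xs) - 1)" for xs :: "nat list" and i
    by (cases "i < length xs") (simp_all add: nth_default_def flip: Cons_nth_drop_Suc)
  then show ?thesis by (simp only:) (intro computability computable_fn_drop assms)
qed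

text \<open>Codes grow at the head, so the list is built backwards: after \<open>m\<close> rounds
  the code holds the last \<open>m\<close> entries.\<close>

lemma list_encode_map_upt:
  "list_encode (map f [0..<n]) = rec_nat 0 (\<lambda>m r. Suc (prod_encode (f (n - Suc m), r))) n"
proof -
  have "m \<le> n \<Longrightarrow> list_encode (map f [n - m..<n]) =
      rec_nat 0 (\<lambda>m r. Suc (prod_encode (f (n - Suc m), r))) m" for m
  proof (induction m)
    case (Suc m)
    then have "[n - Suc m..<n] = (n - Suc m) # [n - m..<n]"
      by (metis Suc_diff_Suc Suc_le_lessD diff_less upt_conv_Cons zero_less_Suc less_le_trans)
    then show ?case using Suc by simp
  qed simp
  from this[of n] show ?thesis by simp
qed

lemma computable_fn_map_upt [computability]:
  assumes "computable_fn b (\<lambda>g z. F g (pfst z) (psnd z))" "computable_fn b N"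
  shows "computable_fn b (\<lambda>g x. list_encode (map (F g x) [0..<N g x]))"
proof -
  have "computable_fn b (\<lambda>g z. F g (pfst z) (N g (pfst z) - Suc (pfst (psnd z))))"
    using computable_fn_comp[OF assms(1),
        of "\<lambda>g z. prod_encode (pfst z, N g (pfst z) - Suc (pfst (psnd z)))"]
      computable_fn_lift[OF assms(2)]
    by (simp add: computability)
  then show ?thesis unfolding list_encode_map_upt by (intro computability assms)
qed

lemma computable_fn_snoc [computability]:
  assumes "computable_fn b (\<lambda>g x. list_encode (L g x))" "computable_fn b F"
  shows "computable_fn b (\<lambda>g x. list_encode (L g x @ [F g x]))"
proof -
  have "xs @ [a] = map (\<lambda>i. if i < length xs then nth_default 0 xs i else a) [0..<Suc (length xs)]"
    for xs and a :: nat
    by (rule nth_equalityI) (auto simp: nth_append nth_default_def less_Suc_eq simp del: upt_Suc)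
  then show ?thesis
    by (simp only:) (intro computability assms assms[THEN computable_fn_lift])
qed

lemma computable_fn_take_append [computability]:
  assumes "computable_fn b (\<lambda>g x. list_encode (L g x))" "computable_fn b (\<lambda>g x. list_encode (M g x))"
    "computable_fn b F"
  shows "computable_fn b (\<lambda>g x. list_encode (take (F g x) (L g x @ M g x)))"
proof -
  have "take n (xs @ ys) = map (\<lambda>i. if i < length xs then nth_default 0 xs i
      else nth_default 0 ys (i - length xs))
      [0..<if n < length xs + length ys then n else length xs + length ys]"
    for xs ys :: "nat list" and n
    by (rule nth_equalityI) (auto simp: nth_append nth_default_def)
  then show ?thesis
    by (simp only:) (intro computability assms assms[THEN computable_fn_lift])
qed

lemma computable_fn_init_seg [computability]:
  assumes "computable_fn False F"
  shows "computable_fn False (\<lambda>g x. list_encode (init_seg g (F g x)))"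
  unfolding init_seg_def by (intro computability assms)

lemma computable_fn_str:
  assumes "computable_str h" "computable_fn b (\<lambda>g x. list_encode (L g x))"
  shows "computable_fn b (\<lambda>g x. h (L g x))"
proof -
  from assms(1) obtain p where "oracle_free p" "\<And>g \<sigma>. eval_prog g p (list_encode \<sigma>) = Some (h \<sigma>)"
    unfolding computable_str_def by blast
  then have "eval_prog g p x = Some (h (list_decode x))" for g x
    by (metis list_decode_inverse)
  then have "computable_fn b (\<lambda>g x. h (list_decode x))"
    unfolding computable_fn_def using \<open>oracle_free p\<close> by blast
  from computable_fn_comp[OF this assms(2)] show ?thesis by simp
qed

lemma computable_strI:
  assumes "computable_fn True (\<lambda>g x. h (list_decode x))"
  shows "computable_str h"
  using assms unfolding computable_fn_def computable_str_def by (metis list_encode_inverse)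

lemma decidable_mem:
  assumes "computable_str (\<lambda>\<sigma>. of_bool (\<sigma> \<in> T))" "computable_fn b (\<lambda>g x. list_encode (L g x))"
  shows "decidable b (\<lambda>g x. L g x \<in> T)"
  unfolding decidable_def using assms by (rule computable_fn_str)

section \<open>Evaluation with finite oracles\<close>

text \<open>Earlier values of the form \<open>Suc v\<close> are defined and nonzero at once; this
  eliminates \<open>LEAST\<close> and suits inductions on programs.\<close>

lemma mu_search_eq_Some_iff:
  "mu_search f = Some n \<longleftrightarrow> f n = Some 0 \<and> (\<forall>m<n. \<exists>v. f m = Some (Suc v))"
proof -
  have least: "(LEAST k. f k = Some 0) = n" if "f n = Some 0" "\<forall>m<n. f m \<noteq> Some 0" for n
    using that by (intro Least_equality) (auto simp: not_less[symmetric])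
  have *: "(\<exists>v. y = Some (Suc v)) \<longleftrightarrow> y \<noteq> None \<and> y \<noteq> Some 0" for y
    by (metis not0_implies_Suc option.exhaust option.inject option.distinct(1) nat.distinct(1))
  show ?thesis
  proof
    assume L: "mu_search f = Some n"
    then obtain k where k: "f k = Some 0" "\<forall>m<k. f m \<noteq> None" and n: "n = (LEAST k. f k = Some 0)"
      unfolding mu_search_def by (auto split: if_splits)
    have "f n = Some 0" unfolding n using k(1) by (rule LeastI)
    moreover have "n \<le> k" unfolding n using k(1) by (rule Least_le)
    moreover have "\<forall>m<n. f m \<noteq> Some 0" unfolding n using not_less_Least by blast
    ultimately show "f n = Some 0 \<and> (\<forall>m<n. \<exists>v. f m = Some (Suc v))"
      using k(2) by (auto simp: *)
  next
    assume "f n = Some 0 \<and> (\<forall>m<n. \<exists>v. f m = Some (Suc v))"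
    then show "mu_search f = Some n"
      using least[of n] unfolding mu_search_def * by auto
  qed
qed

lemma mu_search_of_bool:
  assumes "P n"
  shows "mu_search (\<lambda>m. Some (of_bool (\<not> P m))) = Some (LEAST m. P m)"
proof -
  define k where "k = (LEAST m. P m)"
  have "P k" unfolding k_def using assms by (rule LeastI)
  moreover have "\<not> P m" if "m < k" for m
    using that unfolding k_def by (rule not_less_Least)
  ultimately show ?thesis unfolding mu_search_eq_Some_iff k_def[symmetric] by simp
qed

text \<open>
  Evaluation with the finite oracle \<open>\<tau>\<close>. The length of \<open>\<tau>\<close> also bounds the unbounded searches,
  which makes this a decidable approximation of \<^const>\<open>eval_prog\<close>.
\<close>

primrec eval_str :: "nat list \<Rightarrow> prog \<Rightarrow> nat \<Rightarrow> nat option" where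
  "eval_str \<tau> PZero = (\<lambda>x. Some 0)"
| "eval_str \<tau> PSucc = (\<lambda>x. Some (Suc x))"
| "eval_str \<tau> PFst = (\<lambda>x. Some (pfst x))"
| "eval_str \<tau> PSnd = (\<lambda>x. Some (psnd x))"
| "eval_str \<tau> POracle = (\<lambda>x. if x < length \<tau> then Some (\<tau> ! x) else None)"
| "eval_str \<tau> (PPair p q) =
     (\<lambda>x. Option.bind (eval_str \<tau> p x) (\<lambda>u.
          Option.bind (eval_str \<tau> q x) (\<lambda>v. Some (prod_encode (u, v)))))"
| "eval_str \<tau> (PComp p q) = (\<lambda>x. Option.bind (eval_str \<tau> q x) (eval_str \<tau> p))"
| "eval_str \<tau> (PRec p q) =
     (\<lambda>x. rec_nat (eval_str \<tau> p (pfst x))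
          (\<lambda>i r. Option.bind r (\<lambda>v. eval_str \<tau> q (prod_encode (pfst x, prod_encode (i, v)))))
          (psnd x))"
| "eval_str \<tau> (PMu p) =
     (\<lambda>x. mu_search (\<lambda>n. if n < length \<tau> then eval_str \<tau> p (prod_encode (x, n)) else None))"

lemma length_init_seg [simp]: "length (init_seg g n) = n"
  by (simp add: init_seg_def)

lemma nth_init_seg [simp]: "i < n \<Longrightarrow> init_seg g n ! i = g i"
  by (simp add: init_seg_def)

lemma eval_str_sound: "eval_str (init_seg g m) p x = Some v \<Longrightarrow> eval_prog g p x = Some v"
proof (induction p arbitrary: x v)
  case (PPair p q)
  then show ?case by (auto simp: bind_eq_Some_conv)
next
  case (PComp p q)
  then show ?case by (auto simp: bind_eq_Some_conv)
next
  case (PRec p q)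
  have "rec_nat (eval_str (init_seg g m) p y) (\<lambda>i r. Option.bind r
          (\<lambda>v. eval_str (init_seg g m) q (prod_encode (y, prod_encode (i, v))))) n = Some w \<Longrightarrow>
        rec_nat (eval_prog g p y) (\<lambda>i r. Option.bind r
          (\<lambda>v. eval_prog g q (prod_encode (y, prod_encode (i, v))))) n = Some w" for y n w
    by (induction n arbitrary: w) (auto simp: bind_eq_Some_conv PRec.IH)
  then show ?case using PRec.prems by (auto split: prod.splits)
next
  case (PMu p)
  then show ?case by (auto simp: mu_search_eq_Some_iff split: if_splits)
qed (auto split: if_splits)

text \<open>A longer segment only adds oracle answers and room for searches. Hence the stages of
  several subcomputations can be merged by taking a maximum.\<close>

lemma eval_str_mono:
  assumes "m \<le> m'" "eval_str (init_seg g m) p x = Some v"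
  shows "eval_str (init_seg g m') p x = Some v"
  using assms(2)
proof (induction p arbitrary: x v)
  case (PPair p q)
  then show ?case by (auto simp: bind_eq_Some_conv)
next
  case (PComp p q)
  then show ?case by (auto simp: bind_eq_Some_conv)
next
  case (PRec p q)
  have "rec_nat (eval_str (init_seg g m) p y) (\<lambda>i r. Option.bind r
          (\<lambda>v. eval_str (init_seg g m) q (prod_encode (y, prod_encode (i, v))))) n = Some w \<Longrightarrow>
        rec_nat (eval_str (init_seg g m') p y) (\<lambda>i r. Option.bind r
          (\<lambda>v. eval_str (init_seg g m') q (prod_encode (y, prod_encode (i, v))))) n = Some w" for y n w
    by (induction n arbitrary: w) (auto simp: bind_eq_Some_conv PRec.IH)
  then show ?case using PRec.prems by (auto split: prod.splits)
next
  case (PMu p)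
  then show ?case using assms(1)
    by (auto simp: mu_search_eq_Some_iff split: if_splits)
qed (use assms(1) in \<open>auto split: if_splits\<close>)

text \<open>The use principle: a halting computation asks finitely many oracle questions and makes
  finitely many search steps.\<close>

lemma eval_str_complete:
  "eval_prog g p x = Some v \<Longrightarrow> \<exists>m. eval_str (init_seg g m) p x = Some v"
proof (induction p arbitrary: x v)
  case POracle
  then show ?case by (intro exI[of _ "Suc x"]) simp
next
  case (PPair p q)
  then obtain u w where uw: "eval_prog g p x = Some u" "eval_prog g q x = Some w" "v = prod_encode (u, w)"
    by (auto simp: bind_eq_Some_conv)
  with PPair.IH obtain m n where "eval_str (init_seg g m) p x = Some u" "eval_str (init_seg g n) q x = Some w"
    by metis
  then have "eval_str (init_seg g (max m n)) p x = Some u" "eval_str (init_seg g (max m n)) q x = Some w"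
    by (simp_all add: eval_str_mono[OF max.cobounded1] eval_str_mono[OF max.cobounded2])
  then show ?case using uw(3) by (intro exI[of _ "max m n"]) simp
next
  case (PComp p q)
  then obtain u where u: "eval_prog g q x = Some u" "eval_prog g p u = Some v"
    by (auto simp: bind_eq_Some_conv)
  with PComp.IH obtain m n where "eval_str (init_seg g m) q x = Some u" "eval_str (init_seg g n) p u = Some v"
    by metis
  then have "eval_str (init_seg g (max m n)) q x = Some u" "eval_str (init_seg g (max m n)) p u = Some v"
    by (simp_all add: eval_str_mono[OF max.cobounded1] eval_str_mono[OF max.cobounded2])
  then show ?case by (intro exI[of _ "max m n"]) simp
next
  case (PRec p q)
  have "rec_nat (eval_prog g p y) (\<lambda>i r. Option.bind r
          (\<lambda>v. eval_prog g q (prod_encode (y, prod_encode (i, v))))) n = Some w \<Longrightarrow>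
        \<exists>m. eval_str (init_seg g m) (PRec p q) (prod_encode (y, n)) = Some w" for y n w
  proof (induction n arbitrary: w)
    case 0
    then show ?case using PRec.IH by simp
  next
    case (Suc n)
    then obtain r where r: "rec_nat (eval_prog g p y) (\<lambda>i r. Option.bind r
          (\<lambda>v. eval_prog g q (prod_encode (y, prod_encode (i, v))))) n = Some r"
      "eval_prog g q (prod_encode (y, prod_encode (n, r))) = Some w"
      by (auto simp: bind_eq_Some_conv)
    from Suc.IH[OF r(1)] PRec.IH(2)[OF r(2)] obtain m m' where
      "eval_str (init_seg g m) (PRec p q) (prod_encode (y, n)) = Some r"
      "eval_str (init_seg g m') q (prod_encode (y, prod_encode (n, r))) = Some w"
      by blast
    then have "eval_str (init_seg g (max m m')) (PRec p q) (prod_encode (y, n)) = Some r"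
      "eval_str (init_seg g (max m m')) q (prod_encode (y, prod_encode (n, r))) = Some w"
      using eval_str_mono[OF max.cobounded1] eval_str_mono[OF max.cobounded2] by blast+
    then show ?case by (intro exI[of _ "max m m'"]) simp
  qed
  from this[of "pfst x" "psnd x"] PRec.prems show ?case by (auto split: prod.splits)
next
  case (PMu p)
  then have v: "eval_prog g p (prod_encode (x, v)) = Some 0"
    and "\<forall>i<v. \<exists>w. eval_prog g p (prod_encode (x, i)) = Some (Suc w)"
    by (auto simp: mu_search_eq_Some_iff)
  then have "\<forall>i<v. \<exists>m w. eval_str (init_seg g m) p (prod_encode (x, i)) = Some (Suc w)"
    using PMu.IH by blast
  then obtain M where M: "\<forall>i<v. \<exists>w. eval_str (init_seg g (M i)) p (prod_encode (x, i)) = Some (Suc w)"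
    by metis
  obtain m where m: "eval_str (init_seg g m) p (prod_encode (x, v)) = Some 0"
    using PMu.IH v by blast
  \<comment> \<open>\<open>k\<close> dominates the stages of all tested values, and
    \<open>Suc v\<close> lets the bounded search reach \<open>v\<close> itself.\<close>
  define k where "k = Max (insert (Suc v) (insert m (M ` {..<v})))"
  have k: "Suc v \<le> k" "m \<le> k" "\<And>i. i < v \<Longrightarrow> M i \<le> k"
    unfolding k_def by (rule Max_ge; simp)+
  have "eval_str (init_seg g k) p (prod_encode (x, v)) = Some 0"
    using eval_str_mono[OF k(2) m] .
  moreover have "\<forall>i<v. \<exists>w. eval_str (init_seg g k) p (prod_encode (x, i)) = Some (Suc w)"
    using M eval_str_mono[OF k(3)] by blast
  ultimately show ?case using k by (intro exI[of _ k]) (auto simp: mu_search_eq_Some_iff)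
qed auto

text \<open>Value 0 stands for no answer yet, which turns the approximation into a total
  functional.\<close>

definition option_code :: "nat option \<Rightarrow> nat" where
  "option_code r = (case r of None \<Rightarrow> 0 | Some v \<Rightarrow> Suc v)"

lemma option_code_simps [simp]: "option_code None = 0" "option_code (Some v) = Suc v"
  by (simp_all add: option_code_def)

lemma option_code_bind:
  "option_code (Option.bind r f) =
     (if option_code r = 0 then 0 else option_code (f (option_code r - 1)))"
  by (cases r) simp_all

text \<open>At most one summand is nonzero, namely the one at the result of the search.\<close>

lemma option_code_mu_search:
  "option_code (mu_search (\<lambda>n. if n < L then f n else None)) =
     (\<Sum>n<L. if option_code (f n) = 1 \<and> (\<forall>m<n. 1 < option_code (f m)) then Suc n else 0)"
proof -
  have iff: "mu_search (\<lambda>n. if n < L then f n else None) = Some n \<longleftrightarrow>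
      n < L \<and> option_code (f n) = 1 \<and> (\<forall>m<n. 1 < option_code (f m))" (is "?r = _ \<longleftrightarrow> n < L \<and> ?P n") for n
  proof -
    have "option_code r = 1 \<longleftrightarrow> r = Some 0" "1 < option_code r \<longleftrightarrow> (\<exists>v. r = Some (Suc v))" for r
      by (cases r; simp add: gr0_conv_Suc)+
    then show ?thesis unfolding mu_search_eq_Some_iff by (auto simp: less_trans[of _ n L])
  qed
  show ?thesis
  proof (cases ?r)
    case None
    then have "n < L \<Longrightarrow> \<not> ?P n" for n using iff by simp
    then show ?thesis using None by simp
  next
    case (Some k)
    then have "n < L \<Longrightarrow> ?P n \<longleftrightarrow> n = k" for n using iff by (metis option.inject)
    then have "(\<Sum>n<L. if ?P n then Suc n else 0) = (\<Sum>n<L. if n = k then Suc n else 0)"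
      by (intro sum.cong) auto
    then show ?thesis using Some iff[of k] by simp
  qed
qed

text \<open>Induction on the fixed program \<open>p\<close>. String and input stay arbitrary because
  subprograms run on computed inputs, also under the binders of recursions and searches.\<close>

lemma computable_fn_eval_str [computability]:
  assumes "computable_fn b (\<lambda>g x. list_encode (L g x))" "computable_fn b F"
  shows "computable_fn b (\<lambda>g x. option_code (eval_str (L g x) p (F g x)))"
  using assms
proof (induction p arbitrary: L F)
  case POracle
  have *: "option_code (if i < length xs then Some (xs ! i) else None) =
      (if i < length xs then Suc (nth_default 0 xs i) else 0)" for xs i
    by (simp add: nth_default_def)
  show ?case unfolding eval_str.simps * by (intro computability POracle)
next
  case (PPair p q)
  show ?case unfolding eval_str.simps option_code_bind option_code_simps by (intro computability PPair)
next
  case (PComp p q)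
  show ?case unfolding eval_str.simps option_code_bind by (intro computability PComp)
next
  case (PRec p q)
  have *: "option_code (rec_nat r (\<lambda>i r. Option.bind r (\<lambda>v. f i v)) n) =
      rec_nat (option_code r) (\<lambda>i r. if r = 0 then 0 else option_code (f i (r - 1))) n" for r f n
    by (induction n) (simp_all add: option_code_bind)
  show ?case unfolding eval_str.simps *
    by (intro computability PRec PRec.prems[THEN computable_fn_lift])
next
  case (PMu p)
  show ?case unfolding eval_str.simps option_code_mu_search
    by (intro computability PMu PMu.prems[THEN computable_fn_lift] PMu.prems[THEN computable_fn_lift, THEN computable_fn_lift])
qed (simp_all add: computability)

section \<open>Counting hypotheses\<close>

text \<open>A hypothesis is the initial one or is adopted by a mind change, so \<open>k\<close>
  changes allow at most \<open>k + 1\<close> hypotheses.\<close>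

lemma computable_1_fin_imp_omega_fin:
  assumes "computable_1_fin \<Phi> \<Gamma>"
  shows "computable_1_omega_fin \<Phi> \<Gamma>"
proof -
  from assms obtain \<Psi> k where \<Psi>: "computable_str \<Psi>" "identified_by \<Phi> \<Gamma> \<Psi>"
    and k: "\<forall>g\<in>dom \<Gamma>. finite (mind_changes \<Psi> g) \<and> card (mind_changes \<Psi> g) \<le> k"
    unfolding computable_1_fin_def by blast
  have "finite (hypotheses \<Psi> g) \<and> card (hypotheses \<Psi> g) \<le> Suc k" if "g \<in> dom \<Gamma>" for g
  proof -
    let ?h = "\<lambda>n. \<Psi> (init_seg g n)"
    let ?H = "insert (?h 0) ((\<lambda>n. ?h (Suc n)) ` mind_changes \<Psi> g)"
    have "?h n \<in> ?H" for n
    proof (induction n)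
      case (Suc n)
      then show ?case by (cases "n \<in> mind_changes \<Psi> g") (auto simp: mind_changes_def)
    qed simp
    then have "hypotheses \<Psi> g \<subseteq> ?H" unfolding hypotheses_def by blast
    moreover have fin: "finite (mind_changes \<Psi> g)" and "card (mind_changes \<Psi> g) \<le> k"
      using k that by auto
    moreover have "card ?H \<le> Suc (card (mind_changes \<Psi> g))"
      using card_insert_le_m1 fin by (simp add: card_insert_if card_image_le le_SucI)
    ultimately show ?thesis
      using card_mono[of ?H "hypotheses \<Psi> g"] finite_subset[of "hypotheses \<Psi> g" ?H] by simp
  qed
  then show ?thesis unfolding computable_1_omega_fin_def using \<Psi> by blast
qed

text \<open>Indices are chosen one by one, without uniformity in \<open>i\<close>. Later arguments
  use only finitely many values of \<open>c\<close>.\<close>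

lemma effective_enumeration_choose:
  assumes "effective_enumeration \<Phi>"
  shows "\<exists>c. \<forall>i. \<Phi> (c i) = (\<lambda>g. total_seq (eval_prog g (p i)))"
proof -
  have "(\<lambda>g. total_seq (eval_prog g (p i))) \<in> range \<Phi>" for i
    using assms unfolding effective_enumeration_def partial_computable_def by auto
  then have "\<forall>i. \<exists>e. \<Phi> e = (\<lambda>g. total_seq (eval_prog g (p i)))" by (metis imageE)
  then show ?thesis by (rule choice)
qed

lemma computable_1_omega_fin_imp_fin_1:
  assumes eff: "effective_enumeration \<Phi>" and "computable_1_omega_fin \<Phi> \<Gamma>"
  shows "computable_fin_1 \<Phi> \<Gamma>"
proof -
  from assms(2) obtain \<Psi> k where \<Psi>: "computable_str \<Psi>" and id: "identified_by \<Phi> \<Gamma> \<Psi>"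
    and k: "\<forall>g\<in>dom \<Gamma>. finite (hypotheses \<Psi> g) \<and> card (hypotheses \<Psi> g) \<le> k"
    unfolding computable_1_omega_fin_def by blast
  from eff obtain u where u: "\<And>e g. \<Phi> e g = total_seq (\<lambda>n. eval_prog g u (prod_encode (e, n)))"
    unfolding effective_enumeration_def by blast
  \<comment> \<open>\<open>D i g\<close> holds at most at the stage where the hypothesis numbered
    \<open>i\<close>, counting distinct ones from 0, makes its first appearance.\<close>
  define new where "new g m \<longleftrightarrow> (\<forall>l<m. \<not> \<Psi> (init_seg g l) = \<Psi> (init_seg g m))" for g m
  define D where "D i g m \<longleftrightarrow> new g m \<and> (\<Sum>l<m. of_bool (new g l)) = i" for i m :: nat and g
  have "computable_fn False (\<lambda>g m. \<Psi> (init_seg g m))"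
    by (intro computable_fn_str[OF \<Psi>] computability)
  then obtain h where h: "\<And>g m. eval_prog g h m = Some (\<Psi> (init_seg g m))"
    unfolding computable_fn_def by blast
  have "\<forall>i. \<exists>d. \<forall>g x. eval_prog g d x = Some (of_bool (\<not> D i g (psnd x)))"
  proof
    fix i
    have "computable_fn False (\<lambda>g x. of_bool (\<not> D i g (psnd x)))"
      unfolding D_def new_def by (intro computability computable_fn_str[OF \<Psi>])
    then show "\<exists>d. \<forall>g x. eval_prog g d x = Some (of_bool (\<not> D i g (psnd x)))"
      unfolding computable_fn_def by blast
  qed
  from choice[OF this] obtain d
    where d: "\<And>i g x. eval_prog g (d i) x = Some (of_bool (\<not> D i g (psnd x)))"
    by blast
  \<comment> \<open>The program for \<open>i\<close> searches for that stage and runs the universal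
    program \<open>u\<close> with the hypothesis found there.\<close>
  obtain c where c: "\<And>i. \<Phi> (c i) = (\<lambda>g. total_seq (eval_prog g
      (PComp u (PPair (PComp h (PMu (d i))) (PPair PFst PSnd)))))"
    using effective_enumeration_choose[OF eff,
        of "\<lambda>i. PComp u (PPair (PComp h (PMu (d i))) (PPair PFst PSnd))"] by blast
  define b where "b = Suc (Max (c ` {..k}))"
  have "\<exists>e<b. \<Gamma> g = \<Phi> e g" if g: "g \<in> dom \<Gamma>" for g
  proof -
    from id g obtain e where e: "\<forall>\<^sub>F n in sequentially. \<Psi> (init_seg g n) = e" "\<Phi> e g = \<Gamma> g"
      unfolding identified_by_def by blast
    from e(1) have ex: "\<exists>n. \<Psi> (init_seg g n) = e" by (auto simp: eventually_sequentially)
    define m where "m = (LEAST n. \<Psi> (init_seg g n) = e)"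
    have m: "\<Psi> (init_seg g m) = e" unfolding m_def using ex by (rule LeastI_ex)
    have "\<not> \<Psi> (init_seg g l) = e" if "l < m" for l
      using that unfolding m_def by (rule not_less_Least)
    then have new_m: "new g m" unfolding new_def m by blast
    define i where "i = (\<Sum>l<m. of_bool (new g l) :: nat)"
    \<comment> \<open>Distinct new stages carry distinct hypotheses, so their number is bounded by
      \<open>k\<close>.\<close>
    have "i = card {l. l < m \<and> new g l}"
      unfolding i_def by (simp add: lessThan_def Collect_conj_eq)
    also have "\<dots> = card ((\<lambda>l. \<Psi> (init_seg g l)) ` {l. l < m \<and> new g l})"
    proof (rule card_image[symmetric], rule linorder_inj_onI)
      fix x y assume "x < y" "y \<in> {l. l < m \<and> new g l}"
      then show "\<Psi> (init_seg g x) \<noteq> \<Psi> (init_seg g y)" unfolding new_def by blast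
    qed auto
    also have "\<dots> \<le> card (hypotheses \<Psi> g)"
      using k g unfolding hypotheses_def by (intro card_mono) auto
    finally have "i \<le> k" using k g by (meson order_trans)
    then have "c i < b" unfolding b_def by (simp add: le_imp_less_Suc)
    have "(LEAST n. D i g n) = m"
    proof (rule Least_equality)
      show "D i g m" unfolding D_def i_def using new_m by simp
      show "m \<le> n" if "D i g n" for n
      proof (rule ccontr)
        assume "\<not> m \<le> n"
        \<comment> \<open>\<open>n\<close> would itself be a new stage below \<open>m\<close> and
          raise the count at \<open>m\<close> to at least \<open>i + 1\<close>.\<close>
        then have "(\<Sum>l<Suc n. of_bool (new g l)) \<le> (\<Sum>l<m. of_bool (new g l) :: nat)"
          by (intro sum_mono2) auto
        with that show False unfolding D_def i_def by simp
      qed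
    qed
    moreover have "D i g m" unfolding D_def i_def using new_m by simp
    ultimately have "mu_search (\<lambda>n. Some (of_bool (\<not> D i g n))) = Some m"
      using mu_search_of_bool[of "D i g" m] by simp
    then have "\<Phi> (c i) g = \<Phi> e g" unfolding c u[of e] by (simp add: d h m)
    then show ?thesis using \<open>c i < b\<close> e(2) by metis
  qed
  then show ?thesis unfolding computable_fin_1_def by blast
qed

section \<open>A separating class for a tree\<close>

text \<open>All prefixes of the extended string are tested because \<open>T\<close> may fail to be
  closed under prefixes.\<close>

definition extendible_by :: "nat list set \<Rightarrow> nat list \<Rightarrow> nat \<Rightarrow> bool" where
  "extendible_by T \<sigma> s \<longleftrightarrow>
     (\<exists>\<tau>. length \<tau> = s \<and> set \<tau> \<subseteq> {0, 1} \<and> (\<forall>j\<le>length \<sigma> + s. take j (\<sigma> @ \<tau>) \<in> T))"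

lemma prod_encode_mono: "a \<le> c \<Longrightarrow> b \<le> d \<Longrightarrow> prod_encode (a, b) \<le> prod_encode (c, d)"
  unfolding prod_encode_def triangle_def by (auto intro!: add_mono div_le_mono mult_le_mono)

text \<open>The bound is the code of the all-ones string, the largest among binary strings of its
  length. It makes the search for an extension a bounded one.\<close>

lemma list_encode_binary_le:
  "set \<tau> \<subseteq> {0, 1} \<Longrightarrow> list_encode \<tau> \<le> rec_nat 0 (\<lambda>i r. Suc (prod_encode (1, r))) (length \<tau>)"
  by (induction \<tau>) (auto intro!: prod_encode_mono)

lemma extendible_by_bounded:
  "extendible_by T \<sigma> s \<longleftrightarrow>
     (\<exists>k<Suc (rec_nat 0 (\<lambda>i r. Suc (prod_encode (1, r))) s). length (list_decode k) = s \<and>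
        (\<forall>i<s. nth_default 0 (list_decode k) i < 2) \<and>
        (\<forall>j<Suc (length \<sigma> + s). take j (\<sigma> @ list_decode k) \<in> T))"
    (is "?l \<longleftrightarrow> ?r")
proof
  assume ?l
  then obtain \<tau> where \<tau>: "length \<tau> = s" "set \<tau> \<subseteq> {0, 1}" "\<forall>j\<le>length \<sigma> + s. take j (\<sigma> @ \<tau>) \<in> T"
    unfolding extendible_by_def by blast
  have "\<tau> ! i < 2" if "i < s" for i
    using \<tau>(1,2) nth_mem[of i \<tau>] that by fastforce
  then show ?r using \<tau> list_encode_binary_le[OF \<tau>(2)]
    by (intro exI[of _ "list_encode \<tau>"]) (simp add: nth_default_def less_Suc_eq_le)
next
  assume ?r
  then obtain k where k: "length (list_decode k) = s" "\<forall>i<s. nth_default 0 (list_decode k) i < 2"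
    "\<forall>j<Suc (length \<sigma> + s). take j (\<sigma> @ list_decode k) \<in> T" by blast
  have "a < 2" if "a \<in> set (list_decode k)" for a
    using that k(1,2) by (auto simp: in_set_conv_nth nth_default_def)
  then have "set (list_decode k) \<subseteq> {0, 1}" using less_2_cases by auto
  then show ?l unfolding extendible_by_def using k
    by (intro exI[of _ "list_decode k"]) (simp add: less_Suc_eq_le)
qed

lemma decidable_extendible_by:
  assumes "computable_str (\<lambda>\<sigma>. of_bool (\<sigma> \<in> T))"
    and "computable_fn b (\<lambda>g x. list_encode (L g x))" "computable_fn b S"
  shows "decidable b (\<lambda>g x. extendible_by T (L g x) (S g x))"
  unfolding extendible_by_bounded
  by (intro computability decidable_mem[OF assms(1)] assms(2,3) assms(2,3)[THEN computable_fn_lift]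
      assms(2,3)[THEN computable_fn_lift, THEN computable_fn_lift])

lemma extendible_by_antimono:
  assumes "extendible_by T \<sigma> s" "t \<le> s"
  shows "extendible_by T \<sigma> t"
proof -
  from assms(1) obtain \<tau> where \<tau>: "length \<tau> = s" "set \<tau> \<subseteq> {0, 1}"
    "\<forall>j\<le>length \<sigma> + s. take j (\<sigma> @ \<tau>) \<in> T"
    unfolding extendible_by_def by blast
  have "take j (\<sigma> @ take t \<tau>) = take j (\<sigma> @ \<tau>)" if "j \<le> length \<sigma> + t" for j
    using that by (simp add: min.absorb1 le_diff_conv add.commute)
  then show ?thesis unfolding extendible_by_def using \<tau> assms(2) set_take_subset[of t \<tau>]
    by (intro exI[of _ "take t \<tau>"]) auto
qed

lemma extendible_by_Suc:
  assumes "extendible_by T \<sigma> (Suc s)"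
  shows "extendible_by T (\<sigma> @ [0]) s \<or> extendible_by T (\<sigma> @ [1]) s"
proof -
  from assms obtain \<tau>' where \<tau>': "length \<tau>' = Suc s" "set \<tau>' \<subseteq> {0, 1}"
    "\<forall>j\<le>length \<sigma> + Suc s. take j (\<sigma> @ \<tau>') \<in> T"
    unfolding extendible_by_def by blast
  then obtain a \<tau> where "\<tau>' = a # \<tau>" by (cases \<tau>') auto
  with \<tau>' have \<tau>: "length \<tau> = s" "set \<tau> \<subseteq> {0, 1}" "a \<in> {0, 1}"
    "\<forall>j\<le>length \<sigma> + Suc s. take j (\<sigma> @ a # \<tau>) \<in> T"
    by (simp_all del: take_append)
  then have "extendible_by T (\<sigma> @ [a]) s"
    unfolding extendible_by_def by (intro exI[of _ \<tau>]) (simp del: take_append)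
  then show ?thesis using \<tau>(3) by auto
qed

text \<open>
  \<open>misguided T n v s\<close> says that, by stage \<open>s\<close>, bit \<open>v\<close> is seen to be the wrong choice at the string
  coded by \<open>n\<close>: its subtree dies while that of the other bit is still alive. Which values are
  admissible at \<open>n\<close> does not depend on the values at other places.
\<close>

definition misguided :: "nat list set \<Rightarrow> nat \<Rightarrow> nat \<Rightarrow> nat \<Rightarrow> bool" where
  "misguided T n v s \<longleftrightarrow> 1 < v \<or>
     (\<exists>t<s. \<not> extendible_by T (list_decode n @ [v]) t \<and> extendible_by T (list_decode n @ [1 - v]) t)"

definition guides :: "nat list set \<Rightarrow> baire set" where
  "guides T = {x. \<forall>n s. \<not> misguided T n (x n) s}"

lemma misguided_mono: "misguided T n v s \<Longrightarrow> s \<le> s' \<Longrightarrow> misguided T n v s'"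
  unfolding misguided_def by (meson less_le_trans)

lemma decidable_misguided:
  assumes "computable_str (\<lambda>\<sigma>. of_bool (\<sigma> \<in> T))"
    and "computable_fn b N" "computable_fn b V" "computable_fn b S"
  shows "decidable b (\<lambda>g x. misguided T (N g x) (V g x) (S g x))"
  unfolding misguided_def
  by (intro computability decidable_extendible_by[OF assms(1)] assms(2-4)
      assms(2-4)[THEN computable_fn_lift])

lemma guides_subset_cantor: "guides T \<subseteq> cantor"
proof
  fix x assume "x \<in> guides T"
  then have "\<not> 1 < x n" for n unfolding guides_def misguided_def by blast
  then show "x \<in> cantor" unfolding cantor_def by (auto simp: not_less le_Suc_eq)
qed

text \<open>If both bits were wrong at a string, each subtree would die while the other is alive;
  comparing the two stages contradicts antimonotonicity. Choosing 1 exactly where 0 is wrong gives a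
  member, with no claim that it is computable.\<close>

lemma guides_nonempty: "guides T \<noteq> {}"
proof -
  define wrong where "wrong n v \<longleftrightarrow> (\<exists>t. \<not> extendible_by T (list_decode n @ [v]) t \<and>
      extendible_by T (list_decode n @ [1 - v]) t)" for n v
  have "\<not> wrong n 0 \<or> \<not> wrong n 1" for n
    unfolding wrong_def by (metis diff_self_eq_0 diff_zero extendible_by_antimono nle_le)
  then have "\<not> wrong n (of_bool (wrong n 0))" for n by (cases "wrong n 0") auto
  then have "(\<lambda>n. of_bool (wrong n 0)) \<in> guides T"
    unfolding guides_def misguided_def wrong_def by auto
  then show ?thesis by blast
qed

lemma pi01_guides:
  assumes "computable_str (\<lambda>\<sigma>. of_bool (\<sigma> \<in> T))"
  shows "pi01 (guides T)"
proof -
  \<comment> \<open>Length serves as stage: every value is tested again on each longer initial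
    segment, so a wrong one is caught eventually.\<close>
  define U where "U = {\<tau>. \<forall>i<length \<tau>. \<not> misguided T i (nth_default 0 \<tau> i) (length \<tau>)}"
  have "computable_str (\<lambda>\<tau>. of_bool (\<tau> \<in> U))"
    unfolding U_def mem_Collect_eq
    by (intro computable_strI computability decidable_misguided[OF assms])
  moreover have "x \<in> guides T \<longleftrightarrow> (\<forall>n. init_seg x n \<in> U)" for x
  proof
    show "x \<in> guides T \<Longrightarrow> \<forall>n. init_seg x n \<in> U"
      unfolding guides_def U_def by (auto simp: nth_default_def)
    assume U: "\<forall>n. init_seg x n \<in> U"
    have "\<not> misguided T i (x i) s" for i s
    proof -
      have "\<not> misguided T i (x i) (max (Suc i) s)"
        using U[rule_format, of "max (Suc i) s"] unfolding U_def by (auto simp: nth_default_def)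
      then show ?thesis using misguided_mono max.cobounded2 by blast
    qed
    then show "x \<in> guides T" unfolding guides_def by blast
  qed
  ultimately show ?thesis unfolding pi01_def by blast
qed

primrec walk :: "baire \<Rightarrow> nat \<Rightarrow> nat list" where
  "walk x 0 = []"
| "walk x (Suc n) = walk x n @ [x (list_encode (walk x n))]"

text \<open>Every node of the walk is extendible by every length \<open>s\<close>: a member of
  \<open>R\<close> provides this at the root, and each guided choice preserves it.\<close>

lemma walk_in_pi01:
  assumes R: "R = {g. \<forall>n. init_seg g n \<in> T}" "R \<subseteq> cantor" "R \<noteq> {}" and x: "x \<in> guides T"
  shows "(\<lambda>n. x (list_encode (walk x n))) \<in> R"
proof -
  have alive: "extendible_by T (walk x n) s" for n s
  proof (induction n arbitrary: s)
    case 0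
    from R(3) obtain g where g: "g \<in> R" by blast
    have "take j (init_seg g s) = init_seg g j" if "j \<le> s" for j
      using that by (simp add: init_seg_def take_map)
    moreover have "set (init_seg g s) \<subseteq> {0, 1}"
    proof -
      have "g n \<in> {0, 1}" for n using g R(2) unfolding cantor_def by blast
      then show ?thesis unfolding init_seg_def by (simp add: image_subset_iff)
    qed
    ultimately show ?case using g R(1) unfolding extendible_by_def
      by (intro exI[of _ "init_seg g s"]) simp
  next
    case (Suc n)
    define v where "v = x (list_encode (walk x n))"
    have good: "\<not> misguided T (list_encode (walk x n)) v (Suc s)"
      using x unfolding guides_def v_def by blast
    then have "v = 0 \<or> v = 1" unfolding misguided_def by auto
    then have "extendible_by T (walk x n @ [v]) s \<or> extendible_by T (walk x n @ [1 - v]) s"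
      using extendible_by_Suc[OF Suc[of "Suc s"]] by auto
    \<comment> \<open>If only the other child survived \<open>s\<close> levels, this would be seen
      before stage \<open>Suc s\<close>.\<close>
    moreover from good have
      "\<not> (\<not> extendible_by T (walk x n @ [v]) s \<and> extendible_by T (walk x n @ [1 - v]) s)"
      unfolding misguided_def by (metis lessI list_encode_inverse)
    ultimately show ?case unfolding v_def by auto
  qed
  have "init_seg (\<lambda>n. x (list_encode (walk x n))) n = walk x n" for n
    by (induction n) (simp_all add: init_seg_def)
  \<comment> \<open>For \<open>s = 0\<close> the node itself is among the tested prefixes.\<close>
  moreover have "walk x n \<in> T" for n
    using alive[of n 0] unfolding extendible_by_def by (auto dest: spec[of _ "length (walk x n)"])
  ultimately show ?thesis unfolding R(1) by simp
qed

section \<open>Learning by refutation\<close>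

text \<open>Finitely many values of an arbitrary \<open>c\<close> can be built into a program; this
  makes the learner computable although \<open>c\<close> comes from a nonuniform choice.\<close>

lemma computable_fn_finite_table:
  assumes "computable_fn b F" "\<And>g x. F g x \<le> N"
  shows "computable_fn b (\<lambda>g x. c (F g x))"
proof -
  have "computable_fn b (\<lambda>g x. if F g x < M then c (F g x) else 0)" for M
  proof (induction M)
    case (Suc M)
    have "(if n < Suc M then c n else 0) = (if n = M then c M else if n < M then c n else 0)" for n
      by (auto simp: less_Suc_eq)
    then show ?case by (simp only:) (intro computability assms(1) Suc)
  qed (simp add: computability)
  from this[of "Suc N"] show ?thesis using assms(2) by (simp add: less_Suc_eq_le)
qed

lemma eventually_const_of_mono_bounded:
  fixes f :: "nat \<Rightarrow> nat"
  assumes "mono f" "\<And>n. f n \<le> b"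
  shows "\<exists>m. \<forall>n\<ge>m. f n = f m"
proof -
  have "finite (range f)" unfolding finite_nat_set_iff_bounded_le using assms(2) by blast
  then have "Max (range f) \<in> range f" by (intro Max_in) auto
  then obtain m where m: "Max (range f) = f m" by (rule rangeE)
  show ?thesis
  proof (intro exI[of _ m] allI impI antisym)
    show "f n \<le> f m" for n unfolding m[symmetric] using \<open>finite (range f)\<close> by (rule Max_ge) simp
    show "f m \<le> f n" if "m \<le> n" for n using assms(1) that by (rule monoD)
  qed
qed

text \<open>A change strictly raises the value, so distinct changes lead to distinct values in
  \<open>{1..b}\<close>.\<close>

lemma card_changes_of_mono_bounded:
  fixes f :: "nat \<Rightarrow> nat"
  assumes "mono f" "\<And>n. f n \<le> b"
  shows "finite {n. f (Suc n) \<noteq> f n} \<and> card {n. f (Suc n) \<noteq> f n} \<le> b"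
proof -
  let ?D = "{n. f (Suc n) \<noteq> f n}"
  have inj: "inj_on (\<lambda>n. f (Suc n)) ?D"
  proof (rule linorder_inj_onI)
    fix m n assume "m < n" and n: "n \<in> ?D"
    then have "f (Suc m) \<le> f n" using monoD[OF assms(1)] by simp
    moreover have "f n < f (Suc n)" using n monoD[OF assms(1), of n "Suc n"] by simp
    ultimately show "f (Suc m) \<noteq> f (Suc n)" by simp
  qed auto
  have sub: "(\<lambda>n. f (Suc n)) ` ?D \<subseteq> {1..b}"
  proof
    fix y assume "y \<in> (\<lambda>n. f (Suc n)) ` ?D"
    then obtain n where "y = f (Suc n)" "f (Suc n) \<noteq> f n" by blast
    then show "y \<in> {1..b}" using monoD[OF assms(1), of n "Suc n"] assms(2)[of "Suc n"] by simp
  qed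
  show ?thesis
    using inj_on_finite[OF inj sub] card_inj_on_le[OF inj sub] by simp
qed

text \<open>The length of \<open>\<tau>\<close> bounds at once the places inspected, the evaluation
  and the stage for \<open>misguided\<close>. So refutation is decidable, and any wrong output shows
  up on some initial segment.\<close>

definition refuted :: "nat list set \<Rightarrow> prog \<Rightarrow> nat \<Rightarrow> nat list \<Rightarrow> bool" where
  "refuted T u e \<tau> \<longleftrightarrow> (\<exists>n<length \<tau>. 0 < option_code (eval_str \<tau> u (prod_encode (e, n))) \<and>
     misguided T n (option_code (eval_str \<tau> u (prod_encode (e, n))) - 1) (length \<tau>))"

definition num_refuted :: "nat list set \<Rightarrow> prog \<Rightarrow> nat \<Rightarrow> nat list \<Rightarrow> nat" where
  "num_refuted T u b \<tau> = (\<Sum>e<b. of_bool (refuted T u e \<tau>))"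

lemma refuted_iff:
  "refuted T u e \<tau> \<longleftrightarrow>
     (\<exists>n<length \<tau>. \<exists>v. eval_str \<tau> u (prod_encode (e, n)) = Some v \<and> misguided T n v (length \<tau>))"
proof -
  have "(0 < option_code r \<and> misguided T n (option_code r - 1) s) \<longleftrightarrow>
      (\<exists>v. r = Some v \<and> misguided T n v s)" for r n s
    by (cases r) auto
  then show ?thesis unfolding refuted_def by (simp only:)
qed

lemma decidable_refuted:
  assumes "computable_str (\<lambda>\<sigma>. of_bool (\<sigma> \<in> T))"
    and "computable_fn b (\<lambda>g x. list_encode (L g x))" "computable_fn b E"
  shows "decidable b (\<lambda>g x. refuted T u (E g x) (L g x))"
  unfolding refuted_def
  by (intro computability decidable_misguided[OF assms(1)] assms(2,3) assms(2,3)[THEN computable_fn_lift])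

lemma computable_fn_num_refuted:
  assumes "computable_str (\<lambda>\<sigma>. of_bool (\<sigma> \<in> T))"
    and "computable_fn b (\<lambda>g x. list_encode (L g x))"
  shows "computable_fn b (\<lambda>g x. num_refuted T u c (L g x))"
  unfolding num_refuted_def
  by (intro computability decidable_refuted[OF assms(1)] assms(2) assms(2)[THEN computable_fn_lift])

text \<open>Refutations are never withdrawn. Their count is thus nondecreasing and at most
  \<open>b\<close>, which gives convergence and the bound on mind changes.\<close>

lemma refuted_mono:
  assumes "refuted T u e (init_seg g m)" "m \<le> m'"
  shows "refuted T u e (init_seg g m')"
proof -
  from assms(1) obtain n v where n: "n < m" and v: "eval_str (init_seg g m) u (prod_encode (e, n)) = Some v"
    and mis: "misguided T n v m"
    unfolding refuted_iff by auto
  from eval_str_mono[OF assms(2) v] misguided_mono[OF mis assms(2)] n assms(2) show ?thesis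
    unfolding refuted_iff by (intro exI[of _ n]) auto
qed

lemma num_refuted_le: "num_refuted T u b \<tau> \<le> b"
proof -
  have "num_refuted T u b \<tau> \<le> (\<Sum>e<b. 1)" unfolding num_refuted_def by (intro sum_mono) simp
  then show ?thesis by simp
qed

lemma mono_num_refuted: "mono (\<lambda>n. num_refuted T u b (init_seg g n))"
  unfolding num_refuted_def
  by (intro monoI sum_mono) (auto dest: refuted_mono)

text \<open>Earlier refutations persist, so a new one raises the count strictly. This protects
  unrefuted candidates once the count is final.\<close>

lemma num_refuted_less:
  assumes "m \<le> m'" "e < b" "\<not> refuted T u e (init_seg g m)" "refuted T u e (init_seg g m')"
  shows "num_refuted T u b (init_seg g m) < num_refuted T u b (init_seg g m')"
  unfolding num_refuted_def
  using assms by (intro sum_strict_mono_ex1) (auto dest: refuted_mono)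

text \<open>
  With hypothesis \<open>k\<close> the learner claims that exactly \<open>k\<close> of the first \<open>b\<close> candidates are ever
  refuted. If so, any candidate unrefuted at a stage where \<open>k\<close> refutations have occurred has only
  admissible outputs, so that the outputs of all such partial candidates can be mixed freely.
\<close>

definition trusted_output ::
    "nat list set \<Rightarrow> prog \<Rightarrow> nat \<Rightarrow> nat \<Rightarrow> baire \<Rightarrow> nat \<Rightarrow> nat \<Rightarrow> bool" where
  "trusted_output T u b k g n w \<longleftrightarrow>
     psnd w < b \<and> k \<le> num_refuted T u b (init_seg g (pfst w)) \<and>
     \<not> refuted T u (psnd w) (init_seg g (pfst w)) \<and>
     0 < option_code (eval_str (init_seg g (pfst w)) u (prod_encode (psnd w, n)))"

text \<open>\<open>w\<close> codes a stage and a candidate, so \<open>LEAST\<close> takes the first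
  trusted output met by the search; subtracting 1 undoes \<open>option_code\<close>.\<close>

definition mixed_guide :: "nat list set \<Rightarrow> prog \<Rightarrow> nat \<Rightarrow> nat \<Rightarrow> baire \<Rightarrow> baire" where
  "mixed_guide T u b k g n = (let w = LEAST w. trusted_output T u b k g n w in
     option_code (eval_str (init_seg g (pfst w)) u (prod_encode (psnd w, n))) - 1)"

lemma mixed_guide_prog:
  assumes T: "computable_str (\<lambda>\<sigma>. of_bool (\<sigma> \<in> T))"
  shows "\<exists>q. \<forall>g n. (\<exists>w. trusted_output T u b k g n w) \<longrightarrow> eval_prog g q n = Some (mixed_guide T u b k g n)"
proof -
  have "computable_fn False (\<lambda>g z. of_bool (\<not> trusted_output T u b k g (pfst z) (psnd z)))"
    unfolding trusted_output_def
    by (intro computability decidable_refuted[OF T] computable_fn_num_refuted[OF T])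
  then obtain d where d: "\<And>g z. eval_prog g d z = Some (of_bool (\<not> trusted_output T u b k g (pfst z) (psnd z)))"
    unfolding computable_fn_def by blast
  have "computable_fn False (\<lambda>g z. option_code (eval_str (init_seg g (pfst (psnd z))) u
      (prod_encode (psnd (psnd z), pfst z))) - 1)"
    by (intro computability)
  then obtain v where v: "\<And>g z. eval_prog g v z = Some (option_code (eval_str
      (init_seg g (pfst (psnd z))) u (prod_encode (psnd (psnd z), pfst z))) - 1)"
    unfolding computable_fn_def by blast
  have "eval_prog g (PComp v (PPair (PPair PFst PSnd) (PMu d))) n = Some (mixed_guide T u b k g n)"
    if "trusted_output T u b k g n w" for g n w
    using mu_search_of_bool[of "trusted_output T u b k g n" w, OF that]
    by (simp add: d v mixed_guide_def Let_def)
  then show ?thesis by blast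
qed

text \<open>Iterates \<open>q\<close> along its own choices; \<open>r\<close> depends on
  \<open>q\<close> only and works for every oracle.\<close>

lemma walk_prog:
  "\<exists>r. \<forall>g x. (\<forall>n. eval_prog g q n = Some (x n)) \<longrightarrow>
     (\<forall>n. eval_prog g r n = Some (x (list_encode (walk x n))))"
proof -
  have "computable_fn False (\<lambda>g z. list_encode (list_decode (pfst z) @ [psnd z]))"
    by (intro computability)
  then obtain s where s: "\<And>g z. eval_prog g s z = Some (list_encode (list_decode (pfst z) @ [psnd z]))"
    unfolding computable_fn_def by blast
  \<comment> \<open>The input consists of a dummy parameter 0, the counter and the code of the walk
    so far, which \<open>PComp PSnd PSnd\<close> extracts.\<close>
  define step where "step = PComp s (PPair (PComp PSnd PSnd) (PComp q (PComp PSnd PSnd)))"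
  define r where "r = PComp q (PComp (PRec PZero step) (PPair PZero (PPair PFst PSnd)))"
  have "eval_prog g r n = Some (x (list_encode (walk x n)))"
    if q: "\<forall>n. eval_prog g q n = Some (x n)" for g x n
  proof -
    have "rec_nat (Some 0) (\<lambda>i r. Option.bind r (\<lambda>v. eval_prog g step (prod_encode (0, prod_encode (i, v))))) n
        = Some (list_encode (walk x n))" for n
      by (induction n) (simp_all add: step_def s q)
    then show ?thesis by (simp add: r_def q)
  qed
  then show ?thesis by blast
qed

text \<open>A wrong output would get its candidate refuted later and push the count above
  \<open>k\<close>, against \<open>bound\<close>.\<close>

lemma trusted_output_admissible:
  assumes w: "trusted_output T u b k g n w"
    and bound: "\<And>m. num_refuted T u b (init_seg g m) \<le> k"
  shows "\<not> misguided T n (option_code (eval_str (init_seg g (pfst w)) u (prod_encode (psnd w, n))) - 1) s"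
proof -
  let ?m = "pfst w" and ?e = "psnd w"
  \<comment> \<open>At \<open>m'\<close> the place \<open>n\<close> is inspected and stage
    \<open>s\<close> has been reached.\<close>
  define m' where "m' = max (Suc n) (max s ?m)"
  from w obtain v where v: "eval_str (init_seg g ?m) u (prod_encode (?e, n)) = Some v"
    unfolding trusted_output_def by (cases "eval_str (init_seg g ?m) u (prod_encode (?e, n))") auto
  have "?m \<le> m'" "n < m'" "s \<le> m'" unfolding m'_def by auto
  have "\<not> num_refuted T u b (init_seg g ?m) < num_refuted T u b (init_seg g m')"
    using w bound[of m'] unfolding trusted_output_def by linarith
  then have "\<not> refuted T u ?e (init_seg g m')"
    using w num_refuted_less[of ?m m' ?e b T u g] \<open>?m \<le> m'\<close> unfolding trusted_output_def by blast
  moreover have "eval_str (init_seg g m') u (prod_encode (?e, n)) = Some v"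
    using \<open>?m \<le> m'\<close> v by (rule eval_str_mono)
  ultimately have "\<not> misguided T n v s"
    unfolding refuted_iff using misguided_mono[of T n v s m'] \<open>n < m'\<close> \<open>s \<le> m'\<close> by auto
  then show ?thesis using v by simp
qed

section \<open>The learner and its correctness\<close>

lemma reducible_1_fin_of_guides:
  assumes eff: "effective_enumeration \<Phi>"
    and T: "computable_str (\<lambda>\<sigma>. of_bool (\<sigma> \<in> T))"
    and R: "R = {g. \<forall>n. init_seg g n \<in> T}" "R \<subseteq> cantor" "R \<noteq> {}"
    and red: "reducible (computable_fin_1 \<Phi>) (guides T) P"
  shows "reducible (computable_1_fin \<Phi>) R P"
proof -
  from eff obtain u where u: "\<And>e g. \<Phi> e g = total_seq (\<lambda>n. eval_prog g u (prod_encode (e, n)))"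
    unfolding effective_enumeration_def by blast
  from red obtain \<Gamma> b where \<Gamma>: "\<And>g. g \<in> dom \<Gamma> \<Longrightarrow> \<exists>e<b. \<Gamma> g = \<Phi> e g"
    and dom: "P \<subseteq> dom \<Gamma>" and val: "\<And>g. g \<in> P \<Longrightarrow> the (\<Gamma> g) \<in> guides T"
    unfolding reducible_def computable_fin_1_def by blast
  have cand: "\<exists>e<b. \<exists>x\<in>guides T. \<forall>n. eval_prog g u (prod_encode (e, n)) = Some (x n)" if g: "g \<in> P" for g
  proof -
    obtain e where e: "e < b" "\<Gamma> g = \<Phi> e g" using \<Gamma> dom g by blast
    have "\<Gamma> g \<noteq> None" using dom g by blast
    then obtain x where x: "\<Gamma> g = Some x" by blast
    then have "total_seq (\<lambda>n. eval_prog g u (prod_encode (e, n))) = Some x" using e u by simp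
    then have "\<forall>n. eval_prog g u (prod_encode (e, n)) = Some (x n)"
      unfolding total_seq_def by (auto split: if_splits)
    then show ?thesis using e(1) val[OF g] x by auto
  qed
  let ?N = "\<lambda>g n. num_refuted T u b (init_seg g n)"
  have "\<forall>k. \<exists>q. \<forall>g n. (\<exists>w. trusted_output T u b k g n w) \<longrightarrow> eval_prog g q n = Some (mixed_guide T u b k g n)"
    using mixed_guide_prog[OF T] by blast
  from choice[OF this] obtain q where q: "\<And>k g n. \<exists>w. trusted_output T u b k g n w \<Longrightarrow>
      eval_prog g (q k) n = Some (mixed_guide T u b k g n)"
    by blast
  have "\<forall>k. \<exists>r. \<forall>g x. (\<forall>n. eval_prog g (q k) n = Some (x n)) \<longrightarrow>
     (\<forall>n. eval_prog g r n = Some (x (list_encode (walk x n))))"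
    using walk_prog by blast
  from choice[OF this] obtain r where r: "\<And>k g x n. \<forall>n. eval_prog g (q k) n = Some (x n) \<Longrightarrow>
      eval_prog g (r k) n = Some (x (list_encode (walk x n)))"
    by blast
  from effective_enumeration_choose[OF eff, of r] obtain c where
    c: "\<And>k. \<Phi> (c k) = (\<lambda>g. total_seq (eval_prog g (r k)))" by blast
  \<comment> \<open>The hypothesis depends only on the number of refutations, so it changes at most
    \<open>b\<close> times.\<close>
  define \<Psi> where "\<Psi> \<tau> = c (num_refuted T u b \<tau>)" for \<tau>
  have "computable_str \<Psi>"
    unfolding \<Psi>_def
    by (intro computable_strI computable_fn_num_refuted[OF T] computability num_refuted_le
        computable_fn_finite_table[where c = c and N = b and F = "\<lambda>g x. num_refuted T u b (list_decode x)"])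
  have lim: "\<exists>k. (\<forall>\<^sub>F n in sequentially. ?N g n = k) \<and> (\<forall>n. ?N g n \<le> k)" for g
  proof -
    obtain m where m: "\<forall>n\<ge>m. ?N g n = ?N g m"
      using eventually_const_of_mono_bounded[OF mono_num_refuted[of T u b g] num_refuted_le] by auto
    have "?N g n \<le> ?N g m" for n
      using monoD[OF mono_num_refuted[of T u b g], of n "max n m"] m by (metis max.cobounded1 max.cobounded2)
    then show ?thesis using m unfolding eventually_sequentially by blast
  qed
  have "\<forall>g. \<exists>k. (\<forall>\<^sub>F n in sequentially. ?N g n = k) \<and> (\<forall>n. ?N g n \<le> k)" using lim by blast
  from choice[OF this] obtain K where ev: "\<And>g. \<forall>\<^sub>F n in sequentially. ?N g n = K g"
    and le: "\<And>g n. ?N g n \<le> K g" by blast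
  have correct: "\<exists>y\<in>R. \<Phi> (c (K g)) g = Some y" if g: "g \<in> P" for g
  proof -
    obtain e x where e: "e < b" "x \<in> guides T" "\<And>n. eval_prog g u (prod_encode (e, n)) = Some (x n)"
      using cand[OF g] by blast
    \<comment> \<open>All outputs of \<open>e\<close> agree with the guide \<open>x\<close>, so none
      is ever found wrong.\<close>
    have unref: "\<not> refuted T u e (init_seg g m)" for m
      using e(2) eval_str_sound[of g m u] e(3) unfolding refuted_iff guides_def by fastforce
    \<comment> \<open>Totality: once the count is final and \<open>e\<close> has answered at
      \<open>n\<close>, the candidate \<open>e\<close> itself is trusted.\<close>
    have ex: "\<exists>w. trusted_output T u b (K g) g n w" for n
    proof -
      obtain m0 where m0: "eval_str (init_seg g m0) u (prod_encode (e, n)) = Some (x n)"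
        using eval_str_complete e(3) by blast
      obtain m1 where m1: "\<And>n. n \<ge> m1 \<Longrightarrow> ?N g n = K g"
        using ev[of g] unfolding eventually_sequentially by blast
      have "eval_str (init_seg g (max m0 m1)) u (prod_encode (e, n)) = Some (x n)"
        using m0 by (rule eval_str_mono[rotated]) simp
      then have "trusted_output T u b (K g) g n (prod_encode (max m0 m1, e))"
        unfolding trusted_output_def using e(1) unref m1 by simp
      then show ?thesis by blast
    qed
    let ?x = "mixed_guide T u b (K g) g"
    have "\<not> misguided T n (?x n) s" for n s
      unfolding mixed_guide_def Let_def
      using trusted_output_admissible[OF LeastI_ex[OF ex] le] .
    then have "?x \<in> guides T" unfolding guides_def by blast
    from walk_in_pi01[OF R this] have "(\<lambda>n. ?x (list_encode (walk ?x n))) \<in> R" .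
    moreover have "eval_prog g (r (K g)) n = Some (?x (list_encode (walk ?x n)))" for n
      using q[OF ex] by (intro r) blast
    ultimately show ?thesis unfolding c total_seq_def by simp
  qed
  \<comment> \<open>The mixed guide is known to be total only for \<open>g\<close> in
    \<open>P\<close>, so \<open>\<Delta>\<close> is cut down to \<open>P\<close>.\<close>
  define \<Delta> where "\<Delta> g = (if g \<in> P then \<Phi> (c (K g)) g else None)" for g
  have dom_\<Delta>: "dom \<Delta> = P" using correct unfolding \<Delta>_def by (force split: if_splits)
  have "identified_by \<Phi> \<Delta> \<Psi>"
    unfolding identified_by_def dom_\<Delta> \<Psi>_def
  proof (intro ballI exI conjI)
    fix g assume "g \<in> P"
    show "\<forall>\<^sub>F n in sequentially. c (?N g n) = c (K g)" using ev[of g] by eventually_elim simp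
    show "\<Phi> (c (K g)) g = \<Delta> g" using \<open>g \<in> P\<close> by (simp add: \<Delta>_def)
  qed
  moreover have "finite (mind_changes \<Psi> g) \<and> card (mind_changes \<Psi> g) \<le> b" for g
  proof -
    have "mind_changes \<Psi> g \<subseteq> {n. ?N g (Suc n) \<noteq> ?N g n}"
      unfolding mind_changes_def \<Psi>_def by auto
    moreover have "finite {n. ?N g (Suc n) \<noteq> ?N g n} \<and> card {n. ?N g (Suc n) \<noteq> ?N g n} \<le> b"
      by (rule card_changes_of_mono_bounded[OF mono_num_refuted num_refuted_le])
    ultimately show ?thesis by (meson card_mono finite_subset order_trans)
  qed
  ultimately have "computable_1_fin \<Phi> \<Delta>"
    unfolding computable_1_fin_def using \<open>computable_str \<Psi>\<close> by blast
  moreover have "the (\<Delta> g) \<in> R" if "g \<in> P" for g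
    using correct[OF that] that by (auto simp: \<Delta>_def)
  ultimately show ?thesis unfolding reducible_def using dom_\<Delta> by blast
qed

lemma complete_for_mono:
  assumes "\<And>\<Gamma>. C \<Gamma> \<Longrightarrow> C' \<Gamma>" "complete_for C P"
  shows "complete_for C' P"
  unfolding complete_for_def
proof (intro allI impI)
  fix Q assume "Q \<subseteq> cantor \<and> pi01 Q \<and> Q \<noteq> {}"
  then have "reducible C Q P" using assms(2) unfolding complete_for_def by simp
  then obtain \<Gamma> where "C \<Gamma>" "P \<subseteq> dom \<Gamma>" "\<forall>g\<in>P. the (\<Gamma> g) \<in> Q"
    unfolding reducible_def by (elim exE conjE) (rule that)
  then show "reducible C' Q P" unfolding reducible_def using assms(1) by (intro exI conjI)
qed

theorem corollary20:
  fixes \<Phi> :: "nat \<Rightarrow> baire \<rightharpoonup> baire" and P :: "baire set"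
  assumes "effective_enumeration \<Phi>"
    and "P \<subseteq> cantor" and "pi01 P" and "P \<noteq> {}"
  shows "(complete_for (computable_1_fin \<Phi>) P \<longleftrightarrow> complete_for (computable_1_omega_fin \<Phi>) P) \<and>
         (complete_for (computable_1_omega_fin \<Phi>) P \<longleftrightarrow> complete_for (computable_fin_1 \<Phi>) P)"
proof -
  have "complete_for (computable_1_fin \<Phi>) P" if fin: "complete_for (computable_fin_1 \<Phi>) P"
    unfolding complete_for_def
  proof (intro allI impI, elim conjE)
    fix R assume R: "R \<subseteq> cantor" "pi01 R" "R \<noteq> {}"
    from R(2) obtain T where T: "computable_str (\<lambda>\<sigma>. of_bool (\<sigma> \<in> T))" "R = {g. \<forall>n. init_seg g n \<in> T}"
      unfolding pi01_def by (elim exE conjE) (rule that)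
    \<comment> \<open>Completeness is applied to the guides of the tree, not to \<open>R\<close>
      itself, because a guide can be judged value by value.\<close>
    have "reducible (computable_fin_1 \<Phi>) (guides T) P"
      using fin[unfolded complete_for_def, rule_format, of "guides T"]
        guides_subset_cantor pi01_guides[OF T(1)] guides_nonempty by simp
    then show "reducible (computable_1_fin \<Phi>) R P"
      by (rule reducible_1_fin_of_guides[OF assms(1) T R(1,3)])
  qed
  moreover have "complete_for (computable_1_fin \<Phi>) P \<Longrightarrow> complete_for (computable_1_omega_fin \<Phi>) P"
    using computable_1_fin_imp_omega_fin by (rule complete_for_mono)
  moreover have "complete_for (computable_1_omega_fin \<Phi>) P \<Longrightarrow> complete_for (computable_fin_1 \<Phi>) P"
    using computable_1_omega_fin_imp_fin_1[OF assms(1)] by (rule complete_for_mono)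
  ultimately show ?thesis by blast
qed

end
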